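(* For any integer $n\geq 2$, $\mathcal{A}^{(n)}_{n_2,n_3}=\mathcal{A}^{(2)}_{n_2,n_3}$.
   Context: A cdf $F$ has a Coxian representation with $n\ge 1$ phases and parameters $\mu_1,\dots,\mu_n>0$, $p_1,\dots,p_{n-1}\in(0,1)$ (and $p_n=0$ by convention) if $F(t)=1-(1,0,\dots,0)e^{St}\underline{1}$ for $t\ge 0$, where $\underline{1}$ is the column vector of ones and $S$ is the $n\times n$ upper bidiagonal matrix with $S_{i,i}=-\mu_i$ for $1\le i\le n$ and $S_{i,i+1}=p_i\mu_i$ for $1\le i\le n-1$ (all other entries zero). $\mathcal{C}_0$ is the class of distributions on $\mathbb{R}^+$ having a Coxian representation for which $\mu_i(1-p_i)$ is (strictly) decreasing in $i\in\{1,\dots,n\}$; such a distribution "has at most $m$ phases" if such a representation exists with $n\le m$. For a random variable $Y$ with such a distribution let $m_i=E[Y^i]$ and define the normalized second and third moments $n_2=m_2/m_1^2$ and $n_3=m_3/(m_1m_2)$. $\mathcal{A}^{(n)}_{n_2,n_3}$ is the set of pairs $(n_2,n_3)$ of normalized second and third moments of the distributions belonging to $\mathcal{C}_0$ with at most $n$ phases. *)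

theory Defs
  imports "HOL-Probability.Probability" "Jordan_Normal_Form.Matrix"
begin

text \<open>The dimension of the matrices below varies, so the type-class function \<open>exp\<close> is
  not applicable; the exponential series is taken entrywise. The lemma that follows shows that it
  converges for every real square matrix.\<close>

definition mat_exp :: "real mat \<Rightarrow> real mat" where
  "mat_exp A = mat (dim_row A) (dim_row A) (\<lambda>(i, j). \<Sum>k. (A ^\<^sub>m k) $$ (i, j) / fact k)"

lemma summable_mat_exp:
  fixes A :: "real mat"
  assumes A: "A \<in> carrier_mat n n" and i: "i < n" and j: "j < n"
  shows "summable (\<lambda>k. (A ^\<^sub>m k) $$ (i, j) / fact k)"
proof -
  define c where "c = (\<Sum>a<n. \<Sum>b<n. \<bar>A $$ (a, b)\<bar>)"
  have c: "\<bar>A $$ (a, b)\<bar> \<le> c" if "a < n" "b < n" for a b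
  proof -
    have "\<bar>A $$ (a, b)\<bar> \<le> (\<Sum>b<n. \<bar>A $$ (a, b)\<bar>)"
      by (rule member_le_sum) (use that in auto)
    also have "\<dots> \<le> c" unfolding c_def
      by (rule member_le_sum[of a "{..<n}" "\<lambda>a. \<Sum>b<n. \<bar>A $$ (a, b)\<bar>"])
        (use that in \<open>auto intro: sum_nonneg\<close>)
    finally show ?thesis .
  qed
  have c0: "0 \<le> c" unfolding c_def by (intro sum_nonneg) auto
  have bound: "\<forall>a<n. \<forall>b<n. \<bar>(A ^\<^sub>m k) $$ (a, b)\<bar> \<le> (real n * c) ^ k" for k
  proof (induction k)
    case 0
    then show ?case using A by auto
  next
    case (Suc k)
    show ?case
    proof (intro allI impI)
      fix a b assume ab: "a < n" "b < n"
      have P: "A ^\<^sub>m k \<in> carrier_mat n n" using A by simp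
      have "(A ^\<^sub>m Suc k) $$ (a, b) = (\<Sum>l<n. (A ^\<^sub>m k) $$ (a, l) * A $$ (l, b))"
        using A P ab by (simp add: scalar_prod_def lessThan_atLeast0)
      also have "\<bar>\<dots>\<bar> \<le> (\<Sum>l<n. \<bar>(A ^\<^sub>m k) $$ (a, l) * A $$ (l, b)\<bar>)" by (rule sum_abs)
      also have "\<dots> \<le> (\<Sum>l<n. (real n * c) ^ k * c)"
        by (rule sum_mono) (use Suc c ab c0 in \<open>auto simp: abs_mult intro!: mult_mono\<close>)
      also have "\<dots> = (real n * c) ^ Suc k" by simp
      finally show "\<bar>(A ^\<^sub>m Suc k) $$ (a, b)\<bar> \<le> (real n * c) ^ Suc k" .
    qed
  qed
  have s: "summable (\<lambda>k. (real n * c) ^ k / fact k)"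
    using summable_exp_generic[of "real n * c"] by (simp add: divide_inverse mult.commute)
  show ?thesis
    by (rule summable_comparison_test'[OF s, of 0])
      (use bound i j in \<open>auto simp: divide_right_mono\<close>)
qed

text \<open>Parameters are indexed from 1, matrix entries from 0.\<close>

definition cox_matrix :: "nat \<Rightarrow> (nat \<Rightarrow> real) \<Rightarrow> (nat \<Rightarrow> real) \<Rightarrow> real mat" where
  "cox_matrix n \<mu> p = mat n n (\<lambda>(i, j).
     if j = i then - \<mu> (Suc i) else if j = Suc i then p (Suc i) * \<mu> (Suc i) else 0)"

definition coxian_rep ::
    "(real \<Rightarrow> real) \<Rightarrow> nat \<Rightarrow> (nat \<Rightarrow> real) \<Rightarrow> (nat \<Rightarrow> real) \<Rightarrow> bool" where
  "coxian_rep F n \<mu> p \<longleftrightarrow>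
     1 \<le> n \<and> (\<forall>i\<in>{1..n}. 0 < \<mu> i) \<and> (\<forall>i\<in>{1..<n}. 0 < p i \<and> p i < 1) \<and> p n = 0 \<and>
     (\<forall>t\<ge>0. F t = 1 - scalar_prod (unit_vec n 0)
        (mat_exp (t \<cdot>\<^sub>m cox_matrix n \<mu> p) *\<^sub>v Matrix.vec n (\<lambda>_. 1)))"

definition C0 :: "nat \<Rightarrow> real measure set" where
  "C0 m = {D. real_distribution D \<and> measure D {..<0} = 0 \<and>
     (\<exists>n \<mu> p. n \<le> m \<and> coxian_rep (cdf D) n \<mu> p \<and>
        strict_antimono_on {1..n} (\<lambda>i. \<mu> i * (1 - p i)))}"

text \<open>The Bochner integral is 0 for non-integrable functions; this convention plays no role on
  \<open>C0\<close>, whose members have exponentially decaying tails.\<close>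

definition raw_moment :: "real measure \<Rightarrow> nat \<Rightarrow> real" where
  "raw_moment D i = (LINT x|D. x ^ i)"

definition norm_moment2 :: "real measure \<Rightarrow> real" where
  "norm_moment2 D = raw_moment D 2 / raw_moment D 1 ^ 2"

definition norm_moment3 :: "real measure \<Rightarrow> real" where
  "norm_moment3 D = raw_moment D 3 / (raw_moment D 1 * raw_moment D 2)"

definition moment_region :: "nat \<Rightarrow> (real \<times> real) set" where
  "moment_region n = (\<lambda>D. (norm_moment2 D, norm_moment3 D)) ` C0 n"

end

theory Submission
  imports Defs
begin

text \<open>Let \<open>r\<^sub>k(i)\<close> be \<open>E[Y\<^sup>k] / k!\<close> for the absorption time \<open>Y\<close> of the chain started in phase \<open>i\<close>.
  Conditioning on the first jump gives \<open>r\<^sub>k\<^sub>+\<^sub>1(i) = r\<^sub>k(i) / \<mu>\<^sub>i + p\<^sub>i r\<^sub>k\<^sub>+\<^sub>1(i + 1)\<close>. Decreasing exit rates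
  make the mean \<open>r\<^sub>1\<close> increase with the phase, and then, by backward induction on the phase, the
  recursion makes \<open>r\<^sub>k(i)\<close> strictly log-convex in \<open>k\<close> for \<open>i < n\<close>. So either \<open>n = 1\<close>, or
  \<open>n\<^sub>2 > 2\<close> and \<open>n\<^sub>3 > 3 n\<^sub>2 / 2\<close>. Under these inequalities some two-point distribution on
  \<open>(0, \<infinity>)\<close> has moments \<open>1, n\<^sub>2 / 2, n\<^sub>2 n\<^sub>3 / 6\<close>; mixing exponential laws with means at its two
  points gives a two-phase Coxian law with normalized moments \<open>n\<^sub>2, n\<^sub>3\<close>.\<close>

section \<open>The generator of the phase process, its semigroup and its potential operator\<close>

locale coxian =
  fixes n :: nat and \<mu> p :: "nat \<Rightarrow> real"
  assumes n_pos: "1 \<le> n"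
    and \<mu>_pos: "i \<in> {1..n} \<Longrightarrow> 0 < \<mu> i"
    and p_pos: "i \<in> {1..<n} \<Longrightarrow> 0 < p i"
    and p_less_1: "i \<in> {1..<n} \<Longrightarrow> p i < 1"
    and p_n [simp]: "p n = 0"
begin

lemma p_nonneg: "i \<in> {1..n} \<Longrightarrow> 0 \<le> p i"
  using p_pos[of i] by (cases "i = n") auto

lemma p_le_1: "i \<in> {1..n} \<Longrightarrow> p i \<le> 1"
  using p_less_1[of i] by (cases "i = n") auto

text \<open>The process moves only from phase \<open>i\<close> to \<open>Suc i\<close> or to
  absorption, so facts about a phase follow from those about the next one. For \<open>i = n\<close>
  the induction hypothesis is void, which is the base case.\<close>

lemma backward_induct [consumes 1, case_names step]:
  assumes "i \<in> {1..n}"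
    and "\<And>i. i \<in> {1..n} \<Longrightarrow> (i < n \<Longrightarrow> P (Suc i)) \<Longrightarrow> P i"
  shows "P i"
  using assms(1)
proof (induction "n - i" arbitrary: i rule: less_induct)
  case less
  then show ?case
    by (intro assms(2)[OF less.prems] less.hyps) auto
qed

text \<open>The matrix S acting on column vectors, encoded as functions on phases numbered from 1.
  In the last row the value \<open>u (Suc n)\<close> is cancelled by \<open>p n = 0\<close>.\<close>

definition gen :: "(nat \<Rightarrow> real) \<Rightarrow> nat \<Rightarrow> real" where
  "gen u i = \<mu> i * (p i * u (Suc i) - u i)"

text \<open>Entry \<open>i\<close> of e^(St) u, as a power series in \<open>t\<close>.\<close>

definition flow :: "(nat \<Rightarrow> real) \<Rightarrow> nat \<Rightarrow> real \<Rightarrow> real" where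
  "flow u i t = (\<Sum>k. (gen ^^ k) u i / fact k * t ^ k)"

text \<open>The potential operator: \<^term>\<open>potential u i\<close> is the expected integral of \<open>u\<close> along the
  phase process started in phase \<open>i\<close>.\<close>

definition potential :: "(nat \<Rightarrow> real) \<Rightarrow> nat \<Rightarrow> real" where
  "potential u i = (\<Sum>j\<in>{i..n}. (\<Prod>l\<in>{i..<j}. p l) * u j / \<mu> j)"

text \<open>Since \<open>p n = 0\<close>, the values of \<open>u\<close> outside \<open>{1..n}\<close> are irrelevant.\<close>

lemma gen_cong:
  assumes "\<And>i. i \<in> {1..n} \<Longrightarrow> u i = v i" "i \<in> {1..n}"
  shows "gen u i = gen v i"
  using assms by (cases "i = n") (auto simp: gen_def)

lemma gen_pow_cong:
  assumes "\<And>i. i \<in> {1..n} \<Longrightarrow> u i = v i" "i \<in> {1..n}"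
  shows "(gen ^^ k) u i = (gen ^^ k) v i"
  using assms(2)
proof (induction k arbitrary: i)
  case (Suc k)
  then show ?case using gen_cong[of "(gen ^^ k) u" "(gen ^^ k) v" i] by simp
qed (use assms(1) in simp)

lemma flow_cong:
  assumes "\<And>i. i \<in> {1..n} \<Longrightarrow> u i = v i" "i \<in> {1..n}"
  shows "flow u i = flow v i"
  unfolding flow_def by (simp only: gen_pow_cong[of u v i, OF assms(1) assms(2)])

lemma gen_pow_cmult: "(gen ^^ k) (\<lambda>i. c * u i) = (\<lambda>i. c * (gen ^^ k) u i)"
  by (induction k) (auto simp: gen_def algebra_simps)

text \<open>Since \<open>p i\<close> lies between 0 and 1, one application of \<open>gen\<close>
  multiplies the supremum norm by at most twice the largest rate. Sums over the phases replace the
  maxima in \<open>B\<close> and \<open>C\<close>.\<close>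

lemma gen_pow_bound:
  obtains B C where "\<And>k i. i \<in> {1..n} \<Longrightarrow> \<bar>(gen ^^ k) u i\<bar> \<le> B * C ^ k"
proof -
  define B where "B = (\<Sum>i\<in>{1..n}. \<bar>u i\<bar>)"
  define C where "C = 2 * (\<Sum>i\<in>{1..n}. \<mu> i)"
  have B: "0 \<le> B" unfolding B_def by (simp add: sum_nonneg)
  have \<mu>0: "i \<in> {1..n} \<Longrightarrow> 0 \<le> \<mu> i" for i
    using \<mu>_pos[of i] by simp
  have C: "0 \<le> C" unfolding C_def by (auto intro!: sum_nonneg \<mu>0)
  have "\<bar>(gen ^^ k) u i\<bar> \<le> B * C ^ k" if "i \<in> {1..n}" for k i
    using that
  proof (induction k arbitrary: i)
    case 0
    then show ?case
      unfolding B_def by (auto intro!: member_le_sum[where f = "\<lambda>i. \<bar>u i\<bar>"])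
  next
    case (Suc k)
    let ?v = "(gen ^^ k) u"
    have \<mu>: "2 * \<mu> i \<le> C"
      unfolding C_def using Suc.prems by (auto intro!: member_le_sum \<mu>0)
    have "\<bar>p i * ?v (Suc i)\<bar> \<le> B * C ^ k"
    proof (cases "i = n")
      case True
      then show ?thesis using B C by simp
    next
      case False
      then have "\<bar>?v (Suc i)\<bar> \<le> B * C ^ k" using Suc by auto
      then show ?thesis
        using p_nonneg[OF Suc.prems] p_le_1[OF Suc.prems]
          mult_mono[of "p i" 1 "\<bar>?v (Suc i)\<bar>" "B * C ^ k"]
        by (auto simp: abs_mult)
    qed
    then have "\<bar>p i * ?v (Suc i) - ?v i\<bar> \<le> 2 * (B * C ^ k)"
      using Suc.IH[OF Suc.prems] by linarith
    then have "\<bar>gen ?v i\<bar> \<le> \<mu> i * (2 * (B * C ^ k))"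
      using \<mu>0[OF Suc.prems] by (auto simp: gen_def abs_mult intro!: mult_left_mono)
    also have "\<dots> = 2 * \<mu> i * (B * C ^ k)" by simp
    also have "\<dots> \<le> C * (B * C ^ k)"
      using B C \<mu> by (intro mult_right_mono) auto
    finally show ?case by (simp add: mult_ac)
  qed
  with that show thesis by blast
qed

lemma summable_flow:
  assumes "i \<in> {1..n}"
  shows "summable (\<lambda>k. (gen ^^ k) u i / fact k * t ^ k)"
proof -
  obtain B C where bound: "\<And>k i. i \<in> {1..n} \<Longrightarrow> \<bar>(gen ^^ k) u i\<bar> \<le> B * C ^ k"
    using gen_pow_bound by blast
  have s: "summable (\<lambda>k. B * ((C * \<bar>t\<bar>) ^ k / fact k))"
    using summable_exp_generic[of "C * \<bar>t\<bar>"]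
    by (intro summable_mult) (simp add: divide_inverse mult.commute)
  show ?thesis
  proof (rule summable_comparison_test'[OF s, of 0])
    fix k
    have "norm ((gen ^^ k) u i / fact k * t ^ k) = \<bar>(gen ^^ k) u i\<bar> * \<bar>t\<bar> ^ k / fact k"
      by (simp add: abs_mult power_abs)
    also have "\<dots> \<le> B * C ^ k * \<bar>t\<bar> ^ k / fact k"
      using bound[OF assms] by (intro divide_right_mono mult_right_mono) auto
    finally show "norm ((gen ^^ k) u i / fact k * t ^ k) \<le> B * ((C * \<bar>t\<bar>) ^ k / fact k)"
      by (simp add: power_mult_distrib mult_ac)
  qed
qed

lemma flow_0 [simp]: "flow u i 0 = u i"
  unfolding flow_def by (subst suminf_finite[of "{0}"]) auto

lemma flow_uminus: "flow (\<lambda>i. - u i) i t = - flow u i t" if "i \<in> {1..n}"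
  using suminf_minus[OF summable_flow[OF that, of u t]] gen_pow_cmult[of _ "- 1" u]
  unfolding flow_def by simp

lemma DERIV_flow:
  assumes "i \<in> {1..n}"
  shows "(flow u i has_field_derivative flow (gen u) i t) (at t)"
proof -
  \<comment> \<open>Termwise differentiation shifts the coefficients by one, which amounts to
    replacing \<open>u\<close> by \<open>gen u\<close>.\<close>
  have "diffs (\<lambda>k. (gen ^^ k) u i / fact k) k = (gen ^^ k) (gen u) i / fact k" for k
    unfolding diffs_def funpow_swap1[symmetric] by (simp add: field_simps del: of_nat_Suc)
  then show ?thesis
    unfolding flow_def [abs_def]
    using termdiffs_strong_converges_everywhere[OF summable_flow[OF assms, of u], of t] by simp
qed

text \<open>With \<open>DERIV_flow\<close> this yields the backward equation: the derivative of
  \<open>flow u\<close> is \<open>gen\<close> applied to \<open>flow u\<close>. Phase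
  \<open>n\<close> is treated separately because convergence of the series is known only on
  \<open>{1..n}\<close>.\<close>

lemma flow_gen:
  assumes "i \<in> {1..n}"
  shows "flow (gen u) i t = gen (\<lambda>j. flow u j t) i"
proof (cases "i = n")
  case True
  have "flow (gen u) i t = (\<Sum>k. - \<mu> i * ((gen ^^ k) u i / fact k * t ^ k))"
    unfolding flow_def funpow_swap1[symmetric] using True
    by (simp add: gen_def mult.assoc)
  also have "\<dots> = - \<mu> i * flow u i t"
    unfolding flow_def by (rule suminf_mult[OF summable_flow[OF assms]])
  finally show ?thesis using True by (simp add: gen_def)
next
  case False
  let ?a = "\<lambda>i k. (gen ^^ k) u i / fact k * t ^ k"
  have s: "?a i sums flow u i t" "?a (Suc i) sums flow u (Suc i) t"
    unfolding flow_def using assms False by (intro summable_sums summable_flow; simp)+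
  have "(\<lambda>k. \<mu> i * (p i * ?a (Suc i) k - ?a i k)) sums gen (\<lambda>j. flow u j t) i"
    unfolding gen_def[of "\<lambda>j. flow u j t" i] by (intro sums_mult sums_diff s)
  moreover have "(\<lambda>k. \<mu> i * (p i * ?a (Suc i) k - ?a i k))
      = (\<lambda>k. (gen ^^ k) (gen u) i / fact k * t ^ k)"
    unfolding funpow_swap1[symmetric]
    by (simp add: gen_def fun_eq_iff right_diff_distrib diff_divide_distrib left_diff_distrib)
  ultimately show ?thesis
    unfolding flow_def by (simp add: sums_iff)
qed

lemma potential_rec:
  assumes "i \<in> {1..n}"
  shows "potential u i = u i / \<mu> i + p i * potential u (Suc i)"
proof -
  have "potential u i = u i / \<mu> i + (\<Sum>j\<in>{Suc i..n}. (\<Prod>l\<in>{i..<j}. p l) * u j / \<mu> j)"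
    unfolding potential_def using assms by (simp add: sum.atLeast_Suc_atMost)
  also have "(\<Sum>j\<in>{Suc i..n}. (\<Prod>l\<in>{i..<j}. p l) * u j / \<mu> j) = p i * potential u (Suc i)"
    unfolding potential_def sum_distrib_left
    by (intro sum.cong) (auto simp: prod.atLeast_Suc_lessThan mult_ac)
  finally show ?thesis .
qed

text \<open>This is \<open>potential_rec\<close> solved for \<open>u i\<close>; so
  \<open>potential\<close> acts as the inverse of -S.\<close>

lemma gen_potential: "i \<in> {1..n} \<Longrightarrow> gen (potential u) i = - u i"
  using \<mu>_pos[of i] potential_rec[of i u] by (simp add: gen_def right_diff_distrib distrib_left)

lemma potential_pos:
  assumes "i \<in> {1..n}" "\<And>i. i \<in> {1..n} \<Longrightarrow> 0 < u i"
  shows "0 < potential u i"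
  using assms(1)
proof (induction rule: backward_induct)
  case (step i)
  have "0 \<le> p i * potential u (Suc i)"
    using step p_nonneg[of i] by (cases "i = n") (auto intro!: mult_nonneg_nonneg)
  moreover have "0 < u i / \<mu> i" using assms(2) \<mu>_pos step.hyps by simp
  ultimately show ?case using potential_rec[OF step.hyps, of u] by simp
qed

section \<open>Positivity and exponential decay of the flow\<close>

text \<open>A comparison principle for supersolutions of the backward equation. Once phase
  \<open>Suc i\<close> is known to be nonnegative, the integrating factor
  \<open>exp (\<mu> i * t)\<close> makes \<open>exp (\<mu> i * t) * g i t\<close> nondecreasing in
  \<open>t\<close>.\<close>

lemma comparison:
  assumes "i \<in> {1..n}" "0 \<le> t"
    and deriv: "\<And>i t. i \<in> {1..n} \<Longrightarrow> (g i has_field_derivative g' i t) (at t)"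
    and super: "\<And>i t. i \<in> {1..n} \<Longrightarrow> 0 \<le> t \<Longrightarrow> gen (\<lambda>j. g j t) i \<le> g' i t"
    and init: "\<And>i. i \<in> {1..n} \<Longrightarrow> 0 \<le> g i 0"
  shows "0 \<le> g i t"
  using assms(1,2)
proof (induction arbitrary: t rule: backward_induct)
  case (step i)
  have "exp (\<mu> i * 0) * g i 0 \<le> exp (\<mu> i * t) * g i t"
  proof (rule DERIV_nonneg_imp_nondecreasing[OF step.prems])
    fix x assume x: "0 \<le> x" "x \<le> t"
    have "0 \<le> p i * g (Suc i) x"
      using step p_nonneg[of i] x by (cases "i = n") (auto intro!: mult_nonneg_nonneg)
    then have "0 \<le> \<mu> i * (p i * g (Suc i) x)"
      using \<mu>_pos[OF step.hyps] by simp
    then have "0 \<le> g' i x + \<mu> i * g i x"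
      using super[OF step.hyps x(1)] by (simp add: gen_def algebra_simps)
    moreover have "((\<lambda>x. exp (\<mu> i * x) * g i x) has_field_derivative
        exp (\<mu> i * x) * (g' i x + \<mu> i * g i x)) (at x)"
      by (auto intro!: derivative_eq_intros deriv[OF step.hyps] simp: algebra_simps)
    ultimately show "\<exists>y. ((\<lambda>x. exp (\<mu> i * x) * g i x) has_field_derivative y) (at x) \<and> 0 \<le> y"
      by (intro exI[of _ "exp (\<mu> i * x) * (g' i x + \<mu> i * g i x)"]) simp
  qed
  then have "0 \<le> exp (\<mu> i * t) * g i t" using init[OF step.hyps] by simp
  then show ?case by (simp add: zero_le_mult_iff)
qed

lemma flow_nonneg:
  assumes "i \<in> {1..n}" "0 \<le> t" "\<And>i. i \<in> {1..n} \<Longrightarrow> 0 \<le> u i"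
  shows "0 \<le> flow u i t"
  using assms(1,2) DERIV_flow
  by (rule comparison[where g = "flow u"]) (auto simp: flow_gen assms(3))

text \<open>The potential \<open>c\<close> of the constant 1 satisfies \<open>gen c = - 1 \<le> - \<epsilon> c\<close> for small \<open>\<epsilon>\<close>, so a
  multiple of \<open>e\<^sup>-\<^sup>\<epsilon>\<^sup>t c\<close> dominates the flow.\<close>

lemma flow_exp_bound:
  assumes nonneg: "\<And>i. i \<in> {1..n} \<Longrightarrow> 0 \<le> u i"
  obtains K \<epsilon> where "0 < \<epsilon>" "\<And>i t. i \<in> {1..n} \<Longrightarrow> 0 \<le> t \<Longrightarrow> flow u i t \<le> K i * exp (- (\<epsilon> * t))"
proof -
  define c where "c = potential (\<lambda>_. 1)"
  have c: "0 < c i" if "i \<in> {1..n}" for i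
    unfolding c_def using that by (intro potential_pos) auto
  have gen_c: "gen c i = - 1" if "i \<in> {1..n}" for i
    unfolding c_def using gen_potential[OF that] by simp
  \<comment> \<open>Dividing by the sum of all \<open>c i\<close> ensures
    \<open>\<epsilon> * c i \<le> 1\<close> in every phase at once. Likewise the sum
    \<open>K\<close> below ensures \<open>u i \<le> K * c i\<close>, the initial condition for the
    comparison.\<close>
  define \<epsilon> where "\<epsilon> = 1 / (\<Sum>i\<in>{1..n}. c i)"
  have sum_c: "c i \<le> (\<Sum>i\<in>{1..n}. c i)" if "i \<in> {1..n}" for i
    using that c by (intro member_le_sum) (auto intro: less_imp_le)
  have \<epsilon>: "0 < \<epsilon>"
    unfolding \<epsilon>_def using n_pos sum_c[of n] c[of n] by auto
  have \<epsilon>c: "\<epsilon> * c i \<le> 1" if "i \<in> {1..n}" for i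
    unfolding \<epsilon>_def using sum_c[OF that] c[OF that] by (simp add: divide_le_eq)
  define K where "K = (\<Sum>i\<in>{1..n}. u i / c i)"
  have K: "0 \<le> K" unfolding K_def using c nonneg by (intro sum_nonneg) (simp add: less_imp_le)
  have uK: "u i \<le> K * c i" if "i \<in> {1..n}" for i
  proof -
    have "u i / c i \<le> K"
      unfolding K_def using that c nonneg
      by (intro member_le_sum[where f = "\<lambda>i. u i / c i"]) (auto intro!: divide_nonneg_pos)
    then show ?thesis using c[OF that] by (simp add: divide_le_eq)
  qed
  have "flow u i t \<le> K * c i * exp (- (\<epsilon> * t))" if "i \<in> {1..n}" "0 \<le> t" for i t
  proof -
    have "0 \<le> K * c i * exp (- (\<epsilon> * t)) - flow u i t"
      using that
    proof (rule comparison[where g = "\<lambda>i t. K * c i * exp (- (\<epsilon> * t)) - flow u i t"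
          and g' = "\<lambda>i t. - \<epsilon> * K * c i * exp (- (\<epsilon> * t)) - flow (gen u) i t"])
      fix i t assume i: "i \<in> {1..n}"
      show "((\<lambda>t. K * c i * exp (- (\<epsilon> * t)) - flow u i t) has_field_derivative
          - \<epsilon> * K * c i * exp (- (\<epsilon> * t)) - flow (gen u) i t) (at t)"
        by (auto intro!: derivative_eq_intros DERIV_flow[OF i])
      have "gen (\<lambda>j. K * c j * exp (- (\<epsilon> * t)) - flow u j t) i =
          K * exp (- (\<epsilon> * t)) * gen c i - gen (\<lambda>j. flow u j t) i"
        by (simp add: gen_def algebra_simps)
      also have "\<dots> = - (K * exp (- (\<epsilon> * t))) - flow (gen u) i t"
        using i by (simp add: gen_c flow_gen)
      also have "\<dots> \<le> - (K * exp (- (\<epsilon> * t))) * (\<epsilon> * c i) - flow (gen u) i t"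
        using mult_left_mono[OF \<epsilon>c[OF i], of "K * exp (- (\<epsilon> * t))"] K by simp
      finally show "gen (\<lambda>j. K * c j * exp (- (\<epsilon> * t)) - flow u j t) i \<le>
          - \<epsilon> * K * c i * exp (- (\<epsilon> * t)) - flow (gen u) i t"
        by (simp add: mult_ac)
    qed (use uK in auto)
    then show ?thesis by simp
  qed
  then show thesis by (rule that[OF \<epsilon>])
qed

text \<open>Squeezed between 0 and a multiple of x^k e^(-x) at x = \<open>\<epsilon> * t\<close>.
  This removes the boundary terms at infinity when moments are integrated by parts.\<close>

lemma tendsto_power_mult_flow:
  assumes nonneg: "\<And>i. i \<in> {1..n} \<Longrightarrow> 0 \<le> u i" and i: "i \<in> {1..n}"
  shows "((\<lambda>t. t ^ k * flow u i t) \<longlongrightarrow> 0) at_top"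
proof -
  obtain K \<epsilon> where \<epsilon>: "0 < \<epsilon>"
    and bound: "\<And>i t. i \<in> {1..n} \<Longrightarrow> 0 \<le> t \<Longrightarrow> flow u i t \<le> K i * exp (- (\<epsilon> * t))"
    using flow_exp_bound[where u = u, OF nonneg] by metis
  have "filterlim (\<lambda>t. \<epsilon> * t) at_top at_top"
    using \<epsilon> by (intro filterlim_tendsto_pos_mult_at_top[OF tendsto_const]) (auto intro: filterlim_ident)
  from filterlim_compose[OF tendsto_power_div_exp_0 this]
  have "((\<lambda>t. K i / \<epsilon> ^ k * ((\<epsilon> * t) ^ k / exp (\<epsilon> * t))) \<longlongrightarrow> K i / \<epsilon> ^ k * 0) at_top"
    by (intro tendsto_intros)
  then have lim: "((\<lambda>t. K i / \<epsilon> ^ k * ((\<epsilon> * t) ^ k / exp (\<epsilon> * t))) \<longlongrightarrow> 0) at_top"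
    by simp
  show ?thesis
  proof (rule tendsto_sandwich[OF _ _ tendsto_const lim])
    show "\<forall>\<^sub>F t in at_top. 0 \<le> t ^ k * flow u i t"
      using eventually_ge_at_top[of 0]
      by eventually_elim (auto intro!: mult_nonneg_nonneg flow_nonneg i nonneg)
    show "\<forall>\<^sub>F t in at_top. t ^ k * flow u i t \<le> K i / \<epsilon> ^ k * ((\<epsilon> * t) ^ k / exp (\<epsilon> * t))"
      using eventually_ge_at_top[of 0]
    proof eventually_elim
      case (elim t)
      have "t ^ k * flow u i t \<le> t ^ k * (K i * exp (- (\<epsilon> * t)))"
        using elim bound[OF i elim] by (intro mult_left_mono) auto
      also have "\<dots> = K i / \<epsilon> ^ k * ((\<epsilon> * t) ^ k / exp (\<epsilon> * t))"
        using \<epsilon> by (simp add: exp_minus field_simps)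
      finally show ?case .
    qed
  qed
qed

section \<open>Moment integrals through repeated integration by parts\<close>

text \<open>An antiderivative of \<open>t ^ k * flow (gen u) i t\<close>. Integration by parts
  leaves an integral of a lower power times \<open>flow u\<close>; as \<open>flow u\<close> is minus
  \<open>flow (gen (potential u))\<close>, that integral has the same shape with
  \<open>potential u\<close> in place of \<open>u\<close>.\<close>

fun moment_primitive :: "nat \<Rightarrow> (nat \<Rightarrow> real) \<Rightarrow> nat \<Rightarrow> real \<Rightarrow> real" where
  "moment_primitive 0 u i t = flow u i t"
| "moment_primitive (Suc k) u i t =
     t ^ Suc k * flow u i t + Suc k * moment_primitive k (potential u) i t"

lemma DERIV_moment_primitive:
  assumes "i \<in> {1..n}"
  shows "(moment_primitive k u i has_field_derivative t ^ k * flow (gen u) i t) (at t)"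
proof (induction k arbitrary: u)
  case 0
  then show ?case using DERIV_flow[OF assms] by (simp add: moment_primitive.simps [abs_def])
next
  case (Suc k)
  have "flow (gen (potential u)) i t = flow (\<lambda>i. - u i) i t"
    using flow_cong[of "gen (potential u)" "\<lambda>i. - u i"] gen_potential assms by simp
  then have "flow (gen (potential u)) i t = - flow u i t"
    using flow_uminus[OF assms] by simp
  with Suc.IH[of "potential u"]
  have IH: "(moment_primitive k (potential u) i has_field_derivative - (t ^ k * flow u i t)) (at t)"
    by simp
  have "((\<lambda>t. t ^ Suc k * flow u i t + real (Suc k) * moment_primitive k (potential u) i t)
      has_field_derivative (real (Suc k) * t ^ k * flow u i t + flow (gen u) i t * t ^ Suc k)
        + real (Suc k) * - (t ^ k * flow u i t)) (at t)"
    using DERIV_pow[of "Suc k" t UNIV]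
    by (intro DERIV_add DERIV_mult DERIV_cmult DERIV_flow[OF assms] IH) simp
  then show ?case
    by (simp add: moment_primitive.simps [abs_def] mult_ac del: of_nat_Suc power_Suc)
qed

text \<open>At time 0 every boundary term with a positive power of \<open>t\<close> vanishes. Only
  the innermost flow remains, and the factors \<open>Suc k\<close> multiply to the
  factorial.\<close>

lemma moment_primitive_0: "moment_primitive k u i 0 = fact k * (potential ^^ k) u i"
  by (induction k arbitrary: u) (simp_all add: funpow_Suc_right del: funpow.simps(2))

lemma tendsto_moment_primitive:
  assumes "\<And>i. i \<in> {1..n} \<Longrightarrow> 0 < u i" and i: "i \<in> {1..n}"
  shows "(moment_primitive k u i \<longlongrightarrow> 0) at_top"
  using assms(1)
proof (induction k arbitrary: u)
  case 0
  then show ?case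
    using tendsto_power_mult_flow[of u i 0] i by (auto intro: less_imp_le)
next
  case (Suc k)
  have "((\<lambda>t. t ^ Suc k * flow u i t + Suc k * moment_primitive k (potential u) i t) \<longlongrightarrow>
      0 + real (Suc k) * 0) at_top"
    using Suc.prems i
    by (intro tendsto_add tendsto_mult tendsto_const tendsto_power_mult_flow Suc.IH)
      (auto intro: less_imp_le potential_pos)
  then show ?case by simp
qed


section \<open>The matrix exponential expressed by the flow\<close>

lemma cox_matrix_mult_vec:
  "cox_matrix n \<mu> p *\<^sub>v Matrix.vec n (\<lambda>i. u (Suc i)) = Matrix.vec n (\<lambda>i. gen u (Suc i))"
proof (rule eq_vecI)
  fix i assume "i < dim_vec (Matrix.vec n (\<lambda>i. gen u (Suc i)))"
  then have i: "i < n" by simp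
  let ?b = "p (Suc i) * \<mu> (Suc i)"
  have "(cox_matrix n \<mu> p *\<^sub>v Matrix.vec n (\<lambda>i. u (Suc i))) $ i =
      (\<Sum>j<n. (if j = i then - \<mu> (Suc i) else if j = Suc i then ?b else 0) * u (Suc j))"
    using i by (simp add: cox_matrix_def scalar_prod_def lessThan_atLeast0)
  also have "\<dots> = (\<Sum>j<n. (if j = i then - \<mu> (Suc i) * u (Suc j) else 0)
      + (if j = Suc i then ?b * u (Suc j) else 0))"
    by (intro sum.cong) auto
  also have "\<dots> = - \<mu> (Suc i) * u (Suc i) + (if Suc i < n then ?b * u (Suc (Suc i)) else 0)"
    using i by (simp add: sum.distrib)
  \<comment> \<open>The last row of the matrix has no superdiagonal entry; the right-hand side
    agrees because \<open>p n = 0\<close>.\<close>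
  also have "(if Suc i < n then ?b * u (Suc (Suc i)) else 0) = ?b * u (Suc (Suc i))"
    using i by (cases "Suc i = n") auto
  finally show "(cox_matrix n \<mu> p *\<^sub>v Matrix.vec n (\<lambda>i. u (Suc i))) $ i =
      Matrix.vec n (\<lambda>i. gen u (Suc i)) $ i"
    using i by (simp add: gen_def algebra_simps)
qed (simp add: cox_matrix_def)

lemma cox_matrix_pow_mult_vec:
  "((t \<cdot>\<^sub>m cox_matrix n \<mu> p) ^\<^sub>m k) *\<^sub>v Matrix.vec n (\<lambda>i. u (Suc i)) =
     Matrix.vec n (\<lambda>i. t ^ k * (gen ^^ k) u (Suc i))"
proof (induction k arbitrary: u)
  case 0
  then show ?case by (simp add: cox_matrix_def)
next
  case (Suc k)
  let ?S = "cox_matrix n \<mu> p" and ?v = "Matrix.vec n (\<lambda>i. u (Suc i))"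
  have S: "?S \<in> carrier_mat n n" by (simp add: cox_matrix_def)
  have "((t \<cdot>\<^sub>m ?S) ^\<^sub>m Suc k) *\<^sub>v ?v = ((t \<cdot>\<^sub>m ?S) ^\<^sub>m k) *\<^sub>v ((t \<cdot>\<^sub>m ?S) *\<^sub>v ?v)"
    using S by (simp add: assoc_mult_mat_vec[of _ n n _ n])
  also have "(t \<cdot>\<^sub>m ?S) *\<^sub>v ?v = t \<cdot>\<^sub>v (?S *\<^sub>v ?v)"
    using S by (intro eq_vecI) auto
  also have "\<dots> = Matrix.vec n (\<lambda>i. t * gen u (Suc i))"
    unfolding cox_matrix_mult_vec by (intro eq_vecI) auto
  finally show ?case
    using Suc.IH[of "\<lambda>i. t * gen u i"]
    by (simp add: gen_pow_cmult mult_ac funpow_Suc_right del: funpow.simps(2))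
qed

text \<open>The unit vector selects row 0, that is phase 1, and the vector of ones sums this row.
  The finite sum is then exchanged with the exponential series.\<close>

lemma survival_eq_flow:
  "scalar_prod (unit_vec n 0) (mat_exp (t \<cdot>\<^sub>m cox_matrix n \<mu> p) *\<^sub>v Matrix.vec n (\<lambda>_. 1)) =
     flow (\<lambda>_. 1) 1 t"
proof -
  let ?A = "t \<cdot>\<^sub>m cox_matrix n \<mu> p" and ?v = "Matrix.vec n (\<lambda>_. 1 :: real)"
  have A: "?A \<in> carrier_mat n n" by (simp add: cox_matrix_def)
  have E: "mat_exp ?A \<in> carrier_mat n n" by (simp add: mat_exp_def cox_matrix_def)
  have n0: "0 < n" using n_pos by simp
  have "scalar_prod (unit_vec n 0) (mat_exp ?A *\<^sub>v ?v) = (\<Sum>j<n. mat_exp ?A $$ (0, j))"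
    using E n0 by (subst scalar_prod_left_unit) (auto simp: scalar_prod_def lessThan_atLeast0)
  also have "\<dots> = (\<Sum>j<n. \<Sum>k. (?A ^\<^sub>m k) $$ (0, j) / fact k)"
    using A n0 by (intro sum.cong) (auto simp: mat_exp_def)
  also have "\<dots> = (\<Sum>k. \<Sum>j<n. (?A ^\<^sub>m k) $$ (0, j) / fact k)"
    by (rule suminf_sum[symmetric], rule summable_mat_exp[OF A n0]) simp
  also have "(\<lambda>k. \<Sum>j<n. (?A ^\<^sub>m k) $$ (0, j) / fact k) = (\<lambda>k. (gen ^^ k) (\<lambda>_. 1) 1 / fact k * t ^ k)"
  proof
    fix k
    have row_sum: "(\<Sum>j<n. B $$ (0, j)) = (B *\<^sub>v ?v) $ 0" if "B \<in> carrier_mat n n" for B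
      using n0 that by (auto simp: scalar_prod_def lessThan_atLeast0)
    have "(\<Sum>j<n. (?A ^\<^sub>m k) $$ (0, j)) = ((?A ^\<^sub>m k) *\<^sub>v ?v) $ 0"
      using A by (intro row_sum) simp
    also have "\<dots> = t ^ k * (gen ^^ k) (\<lambda>_. 1) 1"
      using cox_matrix_pow_mult_vec[of t k "\<lambda>_. 1"] n0 by simp
    finally show "(\<Sum>j<n. (?A ^\<^sub>m k) $$ (0, j) / fact k) = (gen ^^ k) (\<lambda>_. 1) 1 / fact k * t ^ k"
      by (simp add: sum_divide_distrib[symmetric])
  qed
  finally show ?thesis by (simp add: flow_def)
qed

section \<open>The absorption time distribution, its cdf and its moments\<close>

text \<open>The density of the absorption time is e^(St) applied to the vector of exit rates, which
  is -S times the vector of ones.\<close>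

definition phase_pdf :: "real \<Rightarrow> real" where
  "phase_pdf t = flow (\<lambda>i. \<mu> i * (1 - p i)) 1 t"

definition phase_dist :: "real measure" where
  "phase_dist = density lborel (\<lambda>t. ennreal (indicator {0..} t * phase_pdf t))"

text \<open>The numbers \<open>r\<^sub>k(i)\<close> of the outline, in matrix form the entries of
  (-S)^(-k) times the vector of ones. For phase 1 the link with moments is
  \<open>raw_moment_dist\<close>.\<close>

definition reduced_moment :: "nat \<Rightarrow> nat \<Rightarrow> real" where
  "reduced_moment k = (potential ^^ k) (\<lambda>_. 1)"

lemma one_phase: "1 \<in> {1..n}"
  using n_pos by simp

lemma pdf_eq: "phase_pdf t = - flow (gen (\<lambda>_. 1)) 1 t"
proof -
  have "(\<lambda>i. \<mu> i * (1 - p i)) = (\<lambda>i. - gen (\<lambda>_. 1) i)"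
    by (auto simp: gen_def algebra_simps)
  then show ?thesis
    unfolding phase_pdf_def by (simp only: flow_uminus[OF one_phase])
qed

lemma pdf_nonneg: "0 \<le> t \<Longrightarrow> 0 \<le> phase_pdf t"
  unfolding phase_pdf_def
  by (rule flow_nonneg[OF one_phase])
    (use \<mu>_pos p_le_1 in \<open>auto intro!: mult_nonneg_nonneg simp: less_imp_le\<close>)

lemma borel_measurable_pdf [measurable]: "phase_pdf \<in> borel_measurable borel"
  unfolding phase_pdf_def [abs_def]
  by (intro borel_measurable_continuous_onI
      DERIV_continuous_on[OF DERIV_flow[OF one_phase, THEN has_field_derivative_at_within]])

lemma reduced_moment_pos: "i \<in> {1..n} \<Longrightarrow> 0 < reduced_moment k i"
  unfolding reduced_moment_def
  by (induction k arbitrary: i) (auto intro: potential_pos)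

lemma DERIV_moment_primitive_one:
  "((\<lambda>t. - moment_primitive k (\<lambda>_. 1) 1 t) has_field_derivative t ^ k * phase_pdf t) (at t)"
  using DERIV_minus[OF DERIV_moment_primitive[OF one_phase, of k "\<lambda>_. 1" t]] by (simp add: pdf_eq)

text \<open>The antiderivative \<open>- moment_primitive\<close> tends to 0 at infinity and equals
  \<open>- fact k * reduced_moment k 1\<close> at 0.\<close>

lemma nn_integral_power_pdf:
  "(\<integral>\<^sup>+t. ennreal (t ^ k * phase_pdf t) * indicator {0..} t \<partial>lborel) = fact k * reduced_moment k 1"
proof -
  have "((\<lambda>t. - moment_primitive k (\<lambda>_. 1) 1 t) \<longlongrightarrow> - 0) at_top"
    by (intro tendsto_minus tendsto_moment_primitive one_phase) simp
  from nn_integral_FTC_atLeast[OF _ DERIV_moment_primitive_one _ this, of 0]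
  show ?thesis
    by (simp add: pdf_nonneg moment_primitive_0 reduced_moment_def)
qed

lemma real_distribution_dist: "real_distribution phase_dist"
proof -
  \<comment> \<open>The total mass is the moment integral for \<open>k = 0\<close>.\<close>
  have "emeasure phase_dist (space phase_dist) = (\<integral>\<^sup>+t. ennreal (t ^ 0 * phase_pdf t) * indicator {0..} t \<partial>lborel)"
    unfolding phase_dist_def
    by (subst emeasure_density) (auto intro!: nn_integral_cong split: split_indicator)
  then have "emeasure phase_dist (space phase_dist) = 1"
    unfolding nn_integral_power_pdf by (simp add: reduced_moment_def)
  then have "prob_space phase_dist" by (rule prob_spaceI)
  then show ?thesis
    by (auto simp: real_distribution_def real_distribution_axioms_def phase_dist_def)
qed

lemma measure_dist_neg: "A \<subseteq> {..<0} \<Longrightarrow> A \<in> sets borel \<Longrightarrow> measure phase_dist A = 0"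
proof -
  assume A: "A \<subseteq> {..<0}" "A \<in> sets borel"
  have "emeasure phase_dist A = (\<integral>\<^sup>+t. ennreal (indicator {0..} t * phase_pdf t) * indicator A t \<partial>lborel)"
    unfolding phase_dist_def using A by (subst emeasure_density) auto
  also have "\<dots> = (\<integral>\<^sup>+(t :: real). 0 \<partial>lborel)"
    using A by (intro nn_integral_cong) (auto split: split_indicator)
  finally show ?thesis by (simp add: measure_def)
qed

lemma cdf_dist: "cdf phase_dist t = (if 0 \<le> t then 1 - flow (\<lambda>_. 1) 1 t else 0)"
proof (cases "0 \<le> t")
  case True
  \<comment> \<open>This keeps \<open>ennreal\<close> from truncating
    \<open>1 - flow (\<lambda>_. 1) 1 t\<close> at 0.\<close>
  have le: "flow (\<lambda>_. 1) 1 t \<le> 1"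
  proof -
    have "- moment_primitive 0 (\<lambda>_. 1) 1 0 \<le> - moment_primitive 0 (\<lambda>_. 1) 1 t"
      using DERIV_moment_primitive_one[of 0] pdf_nonneg
      by (intro DERIV_nonneg_imp_nondecreasing[OF True]) (metis mult_1 power_0)
    then show ?thesis by simp
  qed
  have "emeasure phase_dist {..t} = (\<integral>\<^sup>+x. ennreal (phase_pdf x) * indicator {0..t} x \<partial>lborel)"
    unfolding phase_dist_def
    by (subst emeasure_density) (auto intro!: nn_integral_cong split: split_indicator)
  also have "\<dots> = - flow (\<lambda>_. 1) 1 t - (- flow (\<lambda>_. 1) 1 0)"
    using DERIV_moment_primitive_one[of 0] True pdf_nonneg
    by (intro nn_integral_FTC_Icc) (auto intro: has_field_derivative_at_within simp del: flow_0)
  finally have "emeasure phase_dist {..t} = ennreal (1 - flow (\<lambda>_. 1) 1 t)"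
    by simp
  then show ?thesis using True le by (simp add: cdf_def measure_def)
next
  case False
  then show ?thesis by (auto simp: cdf_def intro!: measure_dist_neg)
qed

lemma raw_moment_dist: "raw_moment phase_dist k = fact k * reduced_moment k 1"
proof -
  have "raw_moment phase_dist k = (\<integral>t. (indicator {0..} t * phase_pdf t) *\<^sub>R t ^ k \<partial>lborel)"
    unfolding raw_moment_def phase_dist_def
    by (rule integral_density) (auto intro!: AE_I2 pdf_nonneg split: split_indicator)
  also have "\<dots> = fact k * reduced_moment k 1"
  proof (intro has_bochner_integral_integral_eq has_bochner_integral_nn_integral)
    have "(\<integral>\<^sup>+t. ennreal ((indicator {0..} t * phase_pdf t) *\<^sub>R t ^ k) \<partial>lborel) =
        (\<integral>\<^sup>+t. ennreal (t ^ k * phase_pdf t) * indicator {0..} t \<partial>lborel)"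
      by (intro nn_integral_cong) (auto simp: mult_ac split: split_indicator)
    then show "(\<integral>\<^sup>+t. ennreal ((indicator {0..} t * phase_pdf t) *\<^sub>R t ^ k) \<partial>lborel) =
        ennreal (fact k * reduced_moment k 1)"
      by (simp add: nn_integral_power_pdf)
  qed (use reduced_moment_pos[OF one_phase, of k] pdf_nonneg in
      \<open>auto intro!: AE_I2 mult_nonneg_nonneg split: split_indicator\<close>)
  finally show ?thesis .
qed

lemma coxian_rep_dist: "coxian_rep (cdf phase_dist) n \<mu> p"
  unfolding coxian_rep_def survival_eq_flow
  using n_pos \<mu>_pos p_pos p_less_1 by (auto simp: cdf_dist)

text \<open>The representation fixes the cdf on \<open>t \<ge> 0\<close>, the absence of negative
  mass fixes it below 0, and the cdf determines the distribution.\<close>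

lemma coxian_rep_unique:
  assumes D: "real_distribution D" "measure D {..<0} = 0" and rep: "coxian_rep (cdf D) n \<mu> p"
  shows "D = phase_dist"
proof (rule cdf_unique[OF D(1) real_distribution_dist])
  interpret real_distribution D by fact
  show "cdf D = cdf phase_dist"
  proof
    fix t
    show "cdf D t = cdf phase_dist t"
    proof (cases "0 \<le> t")
      case True
      then show ?thesis
        using rep unfolding coxian_rep_def survival_eq_flow by (simp add: cdf_dist)
    next
      case False
      then have "measure D {..t} \<le> measure D {..<0}"
        by (intro finite_measure_mono) auto
      then show ?thesis
        using False D(2) by (simp add: cdf_dist) (simp add: cdf_def measure_le_0_iff)
    qed
  qed
qed

lemma norm_moment2_dist: "norm_moment2 phase_dist = 2 * reduced_moment 2 1 / reduced_moment 1 1 ^ 2"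
  by (simp add: norm_moment2_def raw_moment_dist)

lemma norm_moment3_dist:
  "norm_moment3 phase_dist = 3 * reduced_moment 3 1 / (reduced_moment 1 1 * reduced_moment 2 1)"
  by (simp add: norm_moment3_def raw_moment_dist fact_numeral)

lemma reduced_moment_0 [simp]: "reduced_moment 0 i = 1"
  by (simp add: reduced_moment_def)

lemma reduced_moment_Suc:
  "i \<in> {1..n} \<Longrightarrow>
     reduced_moment (Suc k) i = reduced_moment k i / \<mu> i + p i * reduced_moment (Suc k) (Suc i)"
  unfolding reduced_moment_def using potential_rec by simp

end

section \<open>The class \<open>C0\<close> in terms of parameters\<close>

lemma coxian_if_coxian_rep: "coxian_rep F n \<mu> p \<Longrightarrow> coxian n \<mu> p"
  unfolding coxian_rep_def coxian_def by auto

text \<open>Allows moments of members of \<open>C0\<close> to be computed from the parameters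
  alone.\<close>

lemma C0_eq:
  "C0 m = {coxian.phase_dist \<mu> p |n \<mu> p. n \<le> m \<and> coxian n \<mu> p \<and>
     strict_antimono_on {1..n} (\<lambda>i. \<mu> i * (1 - p i))}"
proof (intro Set.set_eqI iffI)
  fix D assume "D \<in> C0 m"
  then obtain n \<mu> p where D: "real_distribution D" "measure D {..<0} = 0" "n \<le> m"
      "coxian_rep (cdf D) n \<mu> p" "strict_antimono_on {1..n} (\<lambda>i. \<mu> i * (1 - p i))"
    unfolding C0_def by blast
  then have "coxian n \<mu> p" by (intro coxian_if_coxian_rep)
  moreover from this D have "D = coxian.phase_dist \<mu> p"
    by (intro coxian.coxian_rep_unique)
  ultimately show "D \<in> {coxian.phase_dist \<mu> p |n \<mu> p. n \<le> m \<and> coxian n \<mu> p \<and>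
      strict_antimono_on {1..n} (\<lambda>i. \<mu> i * (1 - p i))}"
    using D by blast
next
  fix D assume "D \<in> {coxian.phase_dist \<mu> p |n \<mu> p. n \<le> m \<and> coxian n \<mu> p \<and>
      strict_antimono_on {1..n} (\<lambda>i. \<mu> i * (1 - p i))}"
  then obtain n \<mu> p where D: "D = coxian.phase_dist \<mu> p" and n: "n \<le> m"
    and cox: "coxian n \<mu> p" and dec: "strict_antimono_on {1..n} (\<lambda>i. \<mu> i * (1 - p i))"
    by blast
  from cox have "real_distribution D" "measure D {..<0} = 0" "coxian_rep (cdf D) n \<mu> p"
    unfolding D
    by (auto intro: coxian.real_distribution_dist coxian.measure_dist_neg coxian.coxian_rep_dist)
  with n dec show "D \<in> C0 m"
    unfolding C0_def by blast
qed

section \<open>Strict log-convexity of the reduced moments\<close>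

text \<open>The ratios b(k+1)/b(k) are nondecreasing. If a(k+1)/a(k) stays below b(k+1)/b(k), it is
  also below b(k+2)/b(k+1); through the recursion this \<open>cross\<close> inequality gives both
  the next ratio bound and strict log-convexity of \<open>a\<close>.\<close>

lemma log_convex_step:
  fixes a b :: "nat \<Rightarrow> real"
  assumes a_pos: "\<And>k. 0 < a k" and b_pos: "\<And>k. 0 < b k" and q: "0 < q"
    and rec: "\<And>k. a (Suc k) = c * a k + q * b (Suc k)"
    and init: "a 0 = b 0" "a 1 < b 1"
    and conv: "\<And>k. b (Suc k) ^ 2 \<le> b k * b (Suc (Suc k))"
    and c: "0 < c"
  shows "a (Suc k) ^ 2 < a k * a (Suc (Suc k))"
proof -
  have cross: "a (Suc k) * b (Suc k) < a k * b (Suc (Suc k))"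
    if "a (Suc k) * b k < a k * b (Suc k)" for k
  proof -
    have "b k * (a (Suc k) * b (Suc k)) = (a (Suc k) * b k) * b (Suc k)" by simp
    also have "\<dots> < (a k * b (Suc k)) * b (Suc k)"
      using that b_pos by (intro mult_strict_right_mono)
    also have "\<dots> = a k * b (Suc k) ^ 2" by (simp add: power2_eq_square)
    also have "\<dots> \<le> a k * (b k * b (Suc (Suc k)))"
      using conv a_pos by (intro mult_left_mono) (auto intro: less_imp_le)
    also have "\<dots> = b k * (a k * b (Suc (Suc k)))" by simp
    finally show ?thesis using b_pos[of k] by simp
  qed
  have ratio: "a (Suc k) * b k < a k * b (Suc k)" for k
  proof (induction k)
    case 0
    then show ?case using init b_pos[of 0] by simp
  next
    case (Suc k)
    have "c * (a (Suc k) * b (Suc k)) < c * (a k * b (Suc (Suc k)))"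
      using cross[OF Suc] c by simp
    \<comment> \<open>After both uses of the recursion the terms with \<open>q\<close> cancel,
      leaving \<open>c\<close> times the cross inequality.\<close>
    then show ?case
      by (subst rec[of "Suc k"], subst (2) rec[of k]) (simp add: algebra_simps)
  qed
  have "q * (a (Suc k) * b (Suc k)) < q * (a k * b (Suc (Suc k)))"
    using cross[OF ratio] q by simp
  \<comment> \<open>Here the terms with \<open>c\<close> cancel instead.\<close>
  moreover have "a k * a (Suc (Suc k)) - a (Suc k) * a (Suc k) =
      q * (a k * b (Suc (Suc k))) - q * (a (Suc k) * b (Suc k))"
    by (subst rec[of "Suc k"], subst (3) rec[of k]) (simp add: algebra_simps)
  ultimately show ?thesis by (simp add: power2_eq_square)
qed

context coxian
begin

context
  assumes decreasing: "strict_antimono_on {1..n} (\<lambda>i. \<mu> i * (1 - p i))"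
begin

lemma mean_step:
  "i \<in> {1..n} \<Longrightarrow> \<mu> i * reduced_moment 1 i = 1 + \<mu> i * p i * reduced_moment 1 (Suc i)"
  using reduced_moment_Suc[of i 0] \<mu>_pos[of i] by (simp add: field_simps)

lemma exit_rate_less:
  assumes "i \<in> {1..n}" "i < n"
  shows "\<mu> (Suc i) * (1 - p (Suc i)) < \<mu> i * (1 - p i)"
  using monotone_onD[OF decreasing, of i "Suc i"] assms by auto

text \<open>Absorption is certain, so expected time in a phase times its exit rate sums to 1 over
  the phases from \<open>i\<close> on. None of these has a larger exit rate than \<open>i\<close>,
  hence the bound; the induction verifies it phase by phase.\<close>

lemma exit_rate_mult_mean_ge_1:
  "i \<in> {1..n} \<Longrightarrow> 1 \<le> \<mu> i * (1 - p i) * reduced_moment 1 i"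
proof (induction rule: backward_induct)
  case (step i)
  show ?case
  proof (cases "i = n")
    case True
    then show ?thesis using mean_step[OF step.hyps] by simp
  next
    case False
    then have i: "i < n" "Suc i \<in> {1..n}" using step.hyps by auto
    let ?r = "\<mu> i * (1 - p i)" and ?x' = "reduced_moment 1 (Suc i)"
    have \<mu>: "0 < \<mu> i" and p: "0 \<le> p i" "p i < 1"
      using \<mu>_pos p_nonneg p_less_1 step.hyps i by auto
    have "1 \<le> \<mu> (Suc i) * (1 - p (Suc i)) * ?x'" using step.IH i by simp
    also have "\<dots> \<le> ?r * ?x'"
      using exit_rate_less[OF step.hyps i(1)] reduced_moment_pos[OF i(2), of 1]
      by (intro mult_right_mono) auto
    finally have "\<mu> i * p i * 1 \<le> \<mu> i * p i * (?r * ?x')"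
      using \<mu> p by (intro mult_left_mono) auto
    \<comment> \<open>Adding \<open>?r\<close> to both sides and using
      \<open>?r + \<mu> i * p i = \<mu> i\<close>.\<close>
    then have "\<mu> i * 1 \<le> ?r * (1 + \<mu> i * p i * ?x')"
      by (simp add: algebra_simps)
    also have "\<dots> = \<mu> i * (?r * reduced_moment 1 i)"
      unfolding mean_step[OF step.hyps, symmetric] by simp
    finally show ?thesis using \<mu> by simp
  qed
qed

text \<open>The previous bound in phase \<open>Suc i\<close>, combined with the strictly larger exit
  rate of phase \<open>i\<close>, bounds the summand 1 in \<open>mean_step\<close> by the exit rate
  of \<open>i\<close> times the next mean.\<close>

lemma mean_less:
  assumes "i \<in> {1..n}" "i < n"
  shows "reduced_moment 1 i < reduced_moment 1 (Suc i)"
proof -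
  have i': "Suc i \<in> {1..n}" using assms by auto
  let ?x' = "reduced_moment 1 (Suc i)"
  have "1 \<le> \<mu> (Suc i) * (1 - p (Suc i)) * ?x'"
    using exit_rate_mult_mean_ge_1[OF i'] .
  also have "\<dots> < \<mu> i * (1 - p i) * ?x'"
    using exit_rate_less[OF assms] reduced_moment_pos[OF i'] by (intro mult_strict_right_mono)
  finally have "\<mu> i * reduced_moment 1 i < \<mu> i * ?x'"
    unfolding mean_step[OF assms(1)] by (simp add: algebra_simps)
  then show ?thesis using \<mu>_pos[OF assms(1)] by simp
qed

text \<open>Weak log-convexity in the next phase suffices for the strict one here;
  \<open>mean_less\<close> supplies the initial strict inequality.\<close>

lemma reduced_moment_log_convex_aux:
  assumes "i \<in> {1..n}" "i < n"
    and "\<And>k. reduced_moment (Suc k) (Suc i) ^ 2 \<le>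
      reduced_moment k (Suc i) * reduced_moment (Suc (Suc k)) (Suc i)"
  shows "reduced_moment (Suc k) i ^ 2 < reduced_moment k i * reduced_moment (Suc (Suc k)) i"
proof (rule log_convex_step[where b = "\<lambda>k. reduced_moment k (Suc i)" and q = "p i" and c = "1 / \<mu> i"])
  show "reduced_moment (Suc k) i = 1 / \<mu> i * reduced_moment k i + p i * reduced_moment (Suc k) (Suc i)" for k
    using reduced_moment_Suc[OF assms(1)] by simp
qed (use assms mean_less[OF assms(1,2)] \<mu>_pos p_pos in \<open>auto intro: reduced_moment_pos\<close>)

lemma reduced_moment_log_convex:
  "i \<in> {1..n} \<Longrightarrow>
     reduced_moment (Suc k) i ^ 2 \<le> reduced_moment k i * reduced_moment (Suc (Suc k)) i"
proof (induction arbitrary: k rule: backward_induct)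
  case (step i)
  show ?case
  proof (cases "i = n")
    case True
    \<comment> \<open>The last phase is exponential: its reduced moments form a geometric sequence,
      so equality holds.\<close>
    then show ?thesis
      using reduced_moment_Suc[OF step.hyps] by (simp add: power2_eq_square)
  next
    case False
    then show ?thesis
      using reduced_moment_log_convex_aux[OF step.hyps _ step.IH, of k] step.hyps by simp
  qed
qed

lemma reduced_moment_strict_log_convex:
  assumes "i \<in> {1..n}" "i < n"
  shows "reduced_moment (Suc k) i ^ 2 < reduced_moment k i * reduced_moment (Suc (Suc k)) i"
  using reduced_moment_log_convex_aux[OF assms reduced_moment_log_convex] assms by simp

end

end

section \<open>Two-phase laws with prescribed reduced moments\<close>

text \<open>\<open>\<alpha>\<close> and \<open>\<beta>\<close> are the nodes of the two-point distribution on \<open>(0, \<infinity>)\<close> with mean 1, second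
  moment \<open>a\<close> and third moment \<open>b\<close>.\<close>

lemma two_point_nodes:
  fixes a b :: real
  assumes a: "1 < a" and b: "a ^ 2 < b"
  obtains \<alpha> \<beta> where "0 < \<alpha>" "\<alpha> < 1" "1 < \<beta>"
    "\<alpha> + (1 - \<alpha>) * \<beta> = a" "\<alpha> * a + (1 - \<alpha>) * \<beta> ^ 2 = b"
proof -
  \<comment> \<open>The nodes are the roots of x^2 - u x + v. The moments 1, 1, \<open>a\<close>,
    \<open>b\<close> must satisfy the corresponding recurrence, so a = u - v and b = u a - v;
    solving gives \<open>u\<close> and \<open>v\<close>.\<close>
  define u where "u = (b - a) / (a - 1)"
  define v where "v = u - a"
  define s where "s = sqrt (u ^ 2 - 4 * v)"
  define \<alpha> where "\<alpha> = (u - s) / 2"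
  define \<beta> where "\<beta> = (u + s) / 2"
  have "u * (a - 1) = b - a"
    using a unfolding u_def by simp
  then have b_eq: "b = u * a - v"
    unfolding v_def by (simp add: algebra_simps)
  have "v * (a - 1) = b - a ^ 2"
    using b_eq unfolding v_def by (simp add: algebra_simps power2_eq_square)
  then have "0 < v * (a - 1)" using b by simp
  then have v: "0 < v" using a by (simp add: zero_less_mult_iff)
  then have u: "0 < u" using a unfolding v_def by simp
  \<comment> \<open>The polynomial x^2 - u x + v has the value 1 - a < 0 at 1, so its roots lie on
    both sides of 1. Positivity of \<open>v\<close>, which comes from \<open>a ^ 2 < b\<close>,
    makes the smaller root positive.\<close>
  have disc: "(u - 2) ^ 2 < u ^ 2 - 4 * v"
    using a unfolding v_def by (simp add: power2_eq_square algebra_simps)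
  then have s2: "s ^ 2 = u ^ 2 - 4 * v"
    unfolding s_def by (smt (verit) real_sqrt_pow2 zero_le_power2)
  have s_ge: "\<bar>u - 2\<bar> < s"
    using real_sqrt_less_mono[OF disc] unfolding s_def by simp
  have "s < sqrt (u ^ 2)"
    unfolding s_def using v by (intro real_sqrt_less_mono) simp
  then have s_less: "s < u" using u by simp
  have sum: "\<alpha> + \<beta> = u" unfolding \<alpha>_def \<beta>_def by (simp add: field_simps)
  have "\<alpha> * \<beta> = (u ^ 2 - s ^ 2) / 4"
    unfolding \<alpha>_def \<beta>_def by (simp add: field_simps power2_eq_square)
  then have prod: "\<alpha> * \<beta> = v" using s2 by simp
  have a_eq: "\<alpha> + (1 - \<alpha>) * \<beta> = a"
    using sum prod unfolding v_def by (simp add: algebra_simps)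
  have "\<alpha> * a + (1 - \<alpha>) * \<beta> ^ 2 = (\<alpha> + \<beta>) * (\<alpha> + (1 - \<alpha>) * \<beta>) - \<alpha> * \<beta>"
    unfolding a_eq[symmetric] by (simp add: algebra_simps power2_eq_square)
  then have "\<alpha> * a + (1 - \<alpha>) * \<beta> ^ 2 = b"
    using a_eq sum prod b_eq by simp
  with a_eq show thesis
    using s_ge s_less by (intro that[of \<alpha> \<beta>]) (auto simp: \<alpha>_def \<beta>_def)
qed

text \<open>The survival function is the hyperexponential mixture of \<open>e\<^bsup>-t/\<alpha>\<^esup>\<close> and \<open>e\<^bsup>-t/\<beta>\<^esup>\<close> whose
  reduced moments are the moments of the two-point distribution.\<close>

lemma two_phase:
  fixes a b :: real
  assumes "1 < a" "a ^ 2 < b"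
  obtains \<mu> p where "coxian 2 \<mu> p" "strict_antimono_on {1..2} (\<lambda>i. \<mu> i * (1 - p i))"
    "coxian.reduced_moment 2 \<mu> p 1 1 = 1"
    "coxian.reduced_moment 2 \<mu> p 2 1 = a"
    "coxian.reduced_moment 2 \<mu> p 3 1 = b"
proof -
  obtain \<alpha> \<beta> where nodes: "0 < \<alpha>" "\<alpha> < 1" "1 < \<beta>"
    and a: "\<alpha> + (1 - \<alpha>) * \<beta> = a" and b: "\<alpha> * a + (1 - \<alpha>) * \<beta> ^ 2 = b"
    using two_point_nodes[OF assms] by blast
  define \<mu> where "\<mu> = (\<lambda>i. if i = (1 :: nat) then 1 / \<alpha> else 1 / \<beta>)"
  \<comment> \<open>The value of \<open>p 1\<close> makes the mean
    \<open>\<alpha> + p 1 * \<beta>\<close> equal to 1.\<close>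
  define p where "p = (\<lambda>i. if i = (1 :: nat) then (1 - \<alpha>) / \<beta> else 0)"
  have set2: "{1..2} = {1, 2 :: nat}" by auto
  interpret coxian 2 \<mu> p
    by unfold_locales (use nodes in \<open>auto simp: \<mu>_def p_def\<close>)
  \<comment> \<open>Clearing denominators reduces the decrease of the exit rates to
    \<open>1 < \<beta>\<close>.\<close>
  have "1 / \<beta> < 1 / \<alpha> * (1 - (1 - \<alpha>) / \<beta>)"
    using nodes by (simp add: field_simps)
  then have dec: "strict_antimono_on {1..2} (\<lambda>i. \<mu> i * (1 - p i))"
    unfolding set2 by (auto simp: monotone_on_def \<mu>_def p_def)
  have r2: "reduced_moment (Suc k) 2 = \<beta> * reduced_moment k 2" for k
    using reduced_moment_Suc[of 2 k] by (simp add: \<mu>_def p_def)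
  have r1: "reduced_moment (Suc k) 1 =
      \<alpha> * reduced_moment k 1 + (1 - \<alpha>) / \<beta> * reduced_moment (Suc k) 2" for k
    using reduced_moment_Suc[of 1 k] by (simp add: \<mu>_def p_def numeral_2_eq_2)
  have r12: "reduced_moment 1 2 = \<beta>"
    using r2[of 0] by simp
  have r22: "reduced_moment 2 2 = \<beta> ^ 2"
    using r2[of 1] r12 unfolding Suc_1 by (simp only: power2_eq_square)
  have r32: "reduced_moment 3 2 = \<beta> ^ 3"
    using r2[of 2] r22 by (simp add: power2_eq_square power3_eq_cube)
  have m1: "reduced_moment 1 1 = 1"
    using r1[of 0] r12 nodes by simp
  have m2: "reduced_moment 2 1 = a"
    using r1[of 1] nodes unfolding Suc_1 m1 r22 a[symmetric] by (simp add: power2_eq_square)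
  have m3: "reduced_moment 3 1 = b"
    using r1[of 2] r32 nodes unfolding m2 b[symmetric]
    by (simp add: power2_eq_square power3_eq_cube)
  show thesis
    by (rule that[OF coxian_axioms dec m1 m2 m3])
qed

theorem proposition4:
  fixes n :: nat
  assumes "n \<ge> 2"
  shows "moment_region n = moment_region 2"
proof
  show "moment_region 2 \<subseteq> moment_region n"
    unfolding moment_region_def C0_def using assms by (intro image_mono) (blast intro: order_trans)
  show "moment_region n \<subseteq> moment_region 2"
  proof
    fix z assume "z \<in> moment_region n"
    then obtain m \<mu> p where z: "z = (norm_moment2 (coxian.phase_dist \<mu> p), norm_moment3 (coxian.phase_dist \<mu> p))"
      and cox: "coxian m \<mu> p" and dec: "strict_antimono_on {1..m} (\<lambda>i. \<mu> i * (1 - p i))"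
      unfolding moment_region_def C0_eq by blast
    show "z \<in> moment_region 2"
    proof (cases "m \<le> 2")
      case True
      then show ?thesis
        unfolding moment_region_def C0_eq z using cox dec by blast
    next
      case False
      interpret coxian m \<mu> p by fact
      let ?x = "reduced_moment 1 1" and ?y = "reduced_moment 2 1" and ?z = "reduced_moment 3 1"
      have x: "0 < ?x" and y: "0 < ?y" by (rule reduced_moment_pos[OF one_phase])+
      have "1 < m" using False by simp
      \<comment> \<open>The instances 0 and 1 give the two inequalities needed for
        \<open>two_phase\<close>.\<close>
      note convex = reduced_moment_strict_log_convex[OF dec one_phase this]
      have "?x ^ 2 < ?y"
        using convex[of 0] by (simp add: numeral_2_eq_2)
      then have a: "1 < ?y / ?x ^ 2" using x by (simp add: field_simps)
      have "?y ^ 2 < ?x * ?z"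
        using convex[of 1] by (simp add: numeral_2_eq_2 numeral_3_eq_3)
      then have b: "(?y / ?x ^ 2) ^ 2 < ?z / ?x ^ 3"
        using x by (simp add: divide_simps power2_eq_square power3_eq_cube mult_ac)
      \<comment> \<open>Normalized moments are invariant under scaling, so the two-phase law may be
        taken with mean 1; its targets are the reduced moments divided by powers of
        \<open>?x\<close>.\<close>
      obtain \<mu>' p' where cox': "coxian 2 \<mu>' p'"
        and dec': "strict_antimono_on {1..2} (\<lambda>i. \<mu>' i * (1 - p' i))"
        and m1: "coxian.reduced_moment 2 \<mu>' p' 1 1 = 1"
        and m2: "coxian.reduced_moment 2 \<mu>' p' 2 1 = ?y / ?x ^ 2"
        and m3: "coxian.reduced_moment 2 \<mu>' p' 3 1 = ?z / ?x ^ 3"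
        by (rule two_phase[OF a b])
      have "norm_moment2 (coxian.phase_dist \<mu>' p') = norm_moment2 phase_dist"
        unfolding coxian.norm_moment2_dist[OF cox'] norm_moment2_dist m1 m2 by simp
      moreover have "norm_moment3 (coxian.phase_dist \<mu>' p') = norm_moment3 phase_dist"
        unfolding coxian.norm_moment3_dist[OF cox'] norm_moment3_dist m1 m2 m3
        using x y by (simp add: field_simps power2_eq_square power3_eq_cube)
      moreover have "coxian.phase_dist \<mu>' p' \<in> C0 2"
        unfolding C0_eq using cox' dec' by blast
      ultimately show ?thesis
        unfolding moment_region_def z by (intro image_eqI[of _ _ "coxian.phase_dist \<mu>' p'"]) simp_all
    qed
  qed
qed

end
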